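(* Let $p\equiv1\pmod 8$ be a prime. Let $\rho_p$ be the permutation carrying the sequence $\{a_1^2\}_p,\dots,\{a_{(p-1)/4}^2\}_p$ to the sequence $b_1,\dots,b_{(p-1)/4}$ of all biquadratic residues modulo $p$ in $(0,p)$ in ascending order, and let $\lambda_p,\varepsilon_p$ be as defined in the context. Then $$\operatorname{sgn}(\rho_p)=(-1)^{\lambda_p+\varepsilon_p}.$$
   Context: For an integer $x$, $\{x\}_p$ denotes the least nonnegative residue of $x$ modulo $p$. Let $0<a_1<a_2<\dots<a_{(p-1)/4}<p/2$ be all the quadratic residues modulo $p$ in the interval $(0,p/2)$. Then $\{a_1^2\}_p,\dots,\{a_{(p-1)/4}^2\}_p$ are exactly all the biquadratic ($4$-th power) residues modulo $p$ in $(0,p)$, each occurring once. Let $b_1<\dots<b_{(p-1)/4}$ be all the biquadratic residues modulo $p$ in $(0,p)$ in ascending order; $\rho_p$ denotes the corresponding permutation and $\operatorname{sgn}(\rho_p)$ its sign. The rational $4$-th power residue symbol $\left(\frac{x}{p}\right)_4$ is $0$ if $p\mid x$, $1$ if $p\nmid x$ and $x$ is a $4$-th power modulo $p$, and $-1$ otherwise. Let $U_p=\prod_{1\le i<j\le (p-1)/4}\sin\frac{2\pi(a_j^2-a_i^2)}{p}$ (a nonzero real number), and let $\lambda_p=0$ if $U_p>0$, $\lambda_p=1$ if $U_p<0$. Let $\varepsilon_p=\#\left\{(x,y)\in\mathbb Z^2: 0<x,\ 0<y,\ x+y<p/2,\ \left(\frac{x}{p}\right)_4=\left(\frac{y}{p}\right)_4=1\right\}$.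 *)

theory Defs
  imports Complex_Main "HOL-Combinatorics.Permutations" "HOL-Number_Theory.Number_Theory"
begin

text \<open>
  The least nonnegative residue of \<open>x\<close> modulo \<open>p > 0\<close> is \<open>x mod p\<close> on \<^typ>\<open>int\<close>.
  Sequences are lists, so their indices start at \<open>0\<close> instead of \<open>1\<close>.
\<close>

definition quartic_symbol :: "int \<Rightarrow> int \<Rightarrow> int" where
  "quartic_symbol x p =
     (if p dvd x then 0 else if \<exists>y. [y ^ 4 = x] (mod p) then 1 else -1)"

definition half_quad_residues :: "int \<Rightarrow> int list" where
  "half_quad_residues p = sorted_list_of_set {a. 0 < a \<and> 2 * a < p \<and> QuadRes p a}"

definition square_seq :: "int \<Rightarrow> int list" where
  "square_seq p = map (\<lambda>a. a\<^sup>2 mod p) (half_quad_residues p)"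

definition biquad_residues :: "int \<Rightarrow> int list" where
  "biquad_residues p =
     sorted_list_of_set {b. 0 < b \<and> b < p \<and> (\<exists>y. [y ^ 4 = b] (mod p))}"

text \<open>
  The permutation acts on the values: it sends the \<open>i\<close>-th entry of the first sequence to the
  \<open>i\<close>-th entry of the second. It exists and is unique for primes \<open>p \<equiv> 1 (mod 4)\<close>, see
  \<open>rho_unique\<close> below.
\<close>

definition rho :: "int \<Rightarrow> int \<Rightarrow> int" where
  "rho p = (THE r. r permutes set (biquad_residues p) \<and>
                   map r (square_seq p) = biquad_residues p)"

definition U :: "int \<Rightarrow> real" where
  "U p = (let a = half_quad_residues p in
     \<Prod>(i, j) \<in> {(i, j). i < j \<and> j < length a}.
       sin (2 * pi * real_of_int ((a ! j)\<^sup>2 - (a ! i)\<^sup>2) / real_of_int p))"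

text \<open>The case \<open>U p = 0\<close> does not occur for primes \<open>p \<equiv> 1 (mod 4)\<close>, see \<open>U_nonzero\<close> below.\<close>

definition lambda :: "int \<Rightarrow> nat" where
  "lambda p = (if U p > 0 then 0 else 1)"

definition epsilon :: "int \<Rightarrow> nat" where
  "epsilon p = card {(x, y). 0 < x \<and> 0 < y \<and> 2 * (x + y) < p \<and>
                             quartic_symbol x p = 1 \<and> quartic_symbol y p = 1}"

lemma finite_half: "finite {a::int. 0 < a \<and> 2 * a < p \<and> QuadRes p a}"
  by (rule finite_subset[of _ "{0..p}"]) auto

lemma finite_biquad: "finite {b::int. 0 < b \<and> b < p \<and> (\<exists>y. [y ^ 4 = b] (mod p))}"
  by (rule finite_subset[of _ "{0..p}"]) auto

lemma set_half_quad_residues [simp]: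
  "set (half_quad_residues p) = {a. 0 < a \<and> 2 * a < p \<and> QuadRes p a}"
  unfolding half_quad_residues_def using finite_half by simp

lemma set_biquad_residues [simp]:
  "set (biquad_residues p) = {b. 0 < b \<and> b < p \<and> (\<exists>y. [y ^ 4 = b] (mod p))}"
  unfolding biquad_residues_def using finite_biquad by simp

lemma QuadRes_neg:
  assumes "prime p" "[p = 1] (mod 4)" "QuadRes p (a::int)"
  shows "QuadRes p (- a)"
proof -
  obtain y where y: "[y\<^sup>2 = a] (mod p)"
    using assms(3) by (auto simp: QuadRes_def)
  have p4: "p mod 4 = 1" using assms(2) by (simp add: cong_def)
  define q where "q = nat p"
  have pq: "p = int q" using prime_gt_0_int[OF assms(1)] by (simp add: q_def)
  have q: "prime q" using assms(1) pq by simp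
  have "q mod 4 = 1" using p4 pq by presburger
  then have "even ((q - 1) div 2)" by presburger
  then have "[Legendre (- 1) p = 1] (mod p)"
    using euler_criterion[of q "- 1"] q \<open>q mod 4 = 1\<close> pq prime_ge_2_nat[OF q]
    by (cases "q = 2") auto
  moreover have "p > 2" using p4 prime_gt_1_int[OF assms(1)] by presburger
  ultimately have "Legendre (- 1) p = 1"
    by (auto simp: Legendre_def cong_iff_dvd_diff dest: zdvd_imp_le split: if_splits)
  then obtain z where z: "[z\<^sup>2 = -1] (mod p)"
    by (auto simp: Legendre_def QuadRes_def split: if_splits)
  have "[(z * y)\<^sup>2 = (-1) * a] (mod p)"
    unfolding power_mult_distrib using z y by (rule cong_mult)
  then show ?thesis by (auto simp: QuadRes_def)
qed

lemma half_square_inj: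
  assumes "prime (p::int)" "0 < a" "2 * a < p" "0 < b" "2 * b < p" "p dvd a\<^sup>2 - b\<^sup>2"
  shows "a = b"
proof -
  have "p dvd (a - b) * (a + b)" using assms(6) by (simp add: algebra_simps power2_eq_square)
  then consider "p dvd a - b" | "p dvd a + b"
    using assms(1) by (auto simp: prime_dvd_mult_iff)
  then show ?thesis
  proof cases
    case 1
    moreover have "\<bar>a - b\<bar> < p" using assms(2-5) by linarith
    ultimately have "a - b = 0" using dvd_imp_le_int[of "a - b" p] by fastforce
    then show ?thesis by simp
  next
    case 2
    then show ?thesis using assms zdvd_not_zless[of "a + b" p] by auto
  qed
qed

lemma distinct_square_seq:
  assumes "prime p"
  shows "distinct (square_seq p)"
proof -
  have "inj_on (\<lambda>a. a\<^sup>2 mod p) {a. 0 < a \<and> 2 * a < p \<and> QuadRes p a}"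
    by (rule inj_onI) (auto intro!: half_square_inj[OF assms] simp: mod_eq_dvd_iff)
  then show ?thesis
    unfolding square_seq_def by (simp add: distinct_map) (simp add: half_quad_residues_def)
qed

lemma set_square_seq:
  assumes p: "prime p" "[p = 1] (mod 4)"
  shows "set (square_seq p) = set (biquad_residues p)"
proof (intro equalityI subsetI)
  fix b assume "b \<in> set (square_seq p)"
  then obtain a where a: "0 < a" "2 * a < p" "QuadRes p a" "b = a\<^sup>2 mod p"
    by (auto simp: square_seq_def)
  obtain y where "[y\<^sup>2 = a] (mod p)" using a by (auto simp: QuadRes_def)
  then have "[(y\<^sup>2)\<^sup>2 = a\<^sup>2] (mod p)" by (rule cong_pow)
  then have y: "[y ^ 4 = b] (mod p)" using a(4) by (simp add: cong_def flip: power_mult)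
  have "\<not> p dvd a" using a by (simp add: zdvd_not_zless)
  then have "\<not> p dvd a\<^sup>2" using p prime_dvd_power by blast
  then have "b \<noteq> 0" using a(4) by auto
  moreover have "0 \<le> b" "b < p" using a(4) prime_gt_0_int[OF p(1)] by auto
  ultimately show "b \<in> set (biquad_residues p)" using y by auto
next
  fix b assume "b \<in> set (biquad_residues p)"
  then obtain y where b: "0 < b" "b < p" "[y ^ 4 = b] (mod p)" by auto
  define c where "c = y\<^sup>2 mod p"
  have c: "QuadRes p c" "[c\<^sup>2 = b] (mod p)"
    using b(3) by (auto simp: c_def QuadRes_def cong_def power_mod simp flip: power_mult)
  have c': "0 \<le> c" "c < p" using prime_gt_0_int[OF p(1)] by (auto simp: c_def)
  have "c \<noteq> 0" using c(2) b by (auto simp: cong_def)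
  have "odd p" using p(2) by (auto simp: cong_def) presburger
  then have odd: "2 * c \<noteq> p" by auto
  define a where "a = (if 2 * c < p then c else p - c)"
  have "QuadRes p a"
    using c(1) QuadRes_neg[OF p c(1)] by (auto simp: a_def QuadRes_def cong_def)
  moreover have "0 < a" "2 * a < p" using c' \<open>c \<noteq> 0\<close> odd by (auto simp: a_def)
  moreover have "[a\<^sup>2 = c\<^sup>2] (mod p)"
    by (auto simp: a_def cong_iff_dvd_diff power2_eq_square algebra_simps)
  then have "a\<^sup>2 mod p = b" using c(2) b by (simp add: cong_def)
  ultimately show "b \<in> set (square_seq p)" by (auto simp: square_seq_def)
qed

lemma rho_unique:
  assumes p: "prime p" "[p = 1] (mod 4)"
  shows "\<exists>!r. r permutes set (biquad_residues p) \<and> map r (square_seq p) = biquad_residues p"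
proof -
  let ?xs = "square_seq p" and ?ys = "biquad_residues p"
  note dx = distinct_square_seq[OF p(1)] and sx = set_square_seq[OF p]
  have dy: "distinct ?ys" by (simp add: biquad_residues_def)
  have len: "length ?xs = length ?ys" using dx dy sx by (metis distinct_card)
  define r where "r x = (case map_of (zip ?xs ?ys) x of None \<Rightarrow> x | Some y \<Rightarrow> y)" for x
  have r: "r (?xs ! i) = ?ys ! i" if "i < length ?ys" for i
    using that dx len by (simp add: r_def map_of_zip_nth)
  have m: "map r ?xs = ?ys" using r len by (intro nth_equalityI) auto
  have "r ` set ?ys = set ?ys" using m sx by (metis set_map)
  then have "bij_betw r (set ?ys) (set ?ys)"
    unfolding bij_betw_def by (metis List.finite_set endo_inj_surj eq_card_imp_inj_on)
  moreover have "r x = x" if "x \<notin> set ?ys" for x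
    using that sx len by (auto simp: r_def split: option.splits dest!: map_of_SomeD set_zip_leftD)
  ultimately have "r permutes set ?ys" by (rule bij_imp_permutes)
  moreover have "s = r" if "s permutes set ?ys" "map s ?xs = ?ys" for s
  proof
    fix x show "s x = r x"
    proof (cases "x \<in> set ?ys")
      case True
      then show ?thesis using that(2) m sx by (metis map_eq_conv)
    next
      case False
      then show ?thesis using that(1) \<open>r permutes set ?ys\<close> by (simp add: permutes_not_in)
    qed
  qed
  ultimately show ?thesis using m by blast
qed

lemma U_nonzero:
  assumes p: "prime p" "[p = 1] (mod 4)"
  shows "U p \<noteq> 0"
proof -
  let ?a = "half_quad_residues p"
  have "odd p" using p(2) by (auto simp: cong_def) presburger
  have "sin (2 * pi * real_of_int ((?a ! j)\<^sup>2 - (?a ! i)\<^sup>2) / real_of_int p) \<noteq> 0"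
    if ij: "i < j" "j < length ?a" for i j
  proof
    let ?k = "(?a ! j)\<^sup>2 - (?a ! i)\<^sup>2"
    assume "sin (2 * pi * real_of_int ?k / real_of_int p) = 0"
    then obtain n :: int where "2 * pi * real_of_int ?k / real_of_int p = of_int n * pi"
      by (auto simp: sin_zero_iff_int2)
    then have "pi * (2 * real_of_int ?k) = pi * (of_int n * of_int p)"
      using prime_gt_0_int[OF p(1)] by (simp add: field_simps)
    then have "2 * real_of_int ?k = of_int n * of_int p" by (simp only: mult_cancel_left pi_neq_zero simp_thms)
    then have "real_of_int (2 * ?k) = real_of_int (n * p)" by (simp only: of_int_mult of_int_numeral)
    then have "2 * ?k = n * p" by (simp only: of_int_eq_iff)
    then have "p dvd 2 * ?k" by simp
    moreover have "coprime p 2" using \<open>odd p\<close> by simp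
    ultimately have "p dvd ?k" using coprime_dvd_mult_right_iff by blast
    moreover have "?a ! i \<in> set ?a" "?a ! j \<in> set ?a"
      using ij by (simp_all del: set_half_quad_residues)
    ultimately have "?a ! j = ?a ! i"
      using half_square_inj[OF p(1), of "?a ! j" "?a ! i"] by auto
    moreover have "distinct ?a" by (simp add: half_quad_residues_def)
    ultimately show False using ij by (simp add: nth_eq_iff_index_eq)
  qed
  moreover have "finite {(i, j). i < j \<and> j < length ?a}"
    by (rule finite_subset[of _ "{..<length ?a} \<times> {..<length ?a}"]) auto
  ultimately show ?thesis by (auto simp: U_def Let_def)
qed

end

theory Submission
  imports Defs
begin

text \<open>
  The factors of \<open>U p\<close> are the values at pairs of entries of \<open>square_seq p\<close> of the antisymmetric
  function \<open>F x y = sin (2 * pi * (y - x) / p)\<close>. Sorting these entries multiplies the product by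
  \<open>sign (rho p)\<close>, and for \<open>0 < x < y < p\<close> the value \<open>F x y\<close> is negative exactly when
  \<open>y - x > p / 2\<close>. Since \<open>- 1\<close> is a fourth power modulo \<open>p\<close>, the map \<open>(x, y) \<mapsto> (x, p - y)\<close> matches
  such pairs of biquadratic residues with the pairs counted by \<open>epsilon p\<close>.
\<close>

section \<open>Antisymmetric products under permutations of the values\<close>

definition ascending_pairs :: "'a::linorder set \<Rightarrow> ('a \<times> 'a) set" where
  "ascending_pairs S = {(x, y). x \<in> S \<and> y \<in> S \<and> x < y}"

lemma finite_ascending_pairs [simp]: "finite S \<Longrightarrow> finite (ascending_pairs S)"
  by (rule finite_subset[of _ "S \<times> S"]) (auto simp: ascending_pairs_def)

text \<open>The inverted pairs are \<open>(a, b)\<close> itself and, for every \<open>c\<close> of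
  \<open>S\<close> strictly between \<open>a\<close> and \<open>b\<close>, the two pairs
  \<open>(a, c)\<close> and \<open>(c, b)\<close>.\<close>

lemma odd_card_inversions_transpose:
  fixes S :: "'a::linorder set"
  assumes S: "finite S" and ab: "a \<in> S" "b \<in> S" "a < b"
  shows "odd (card {(x, y) \<in> ascending_pairs S. transpose a b y < transpose a b x})"
proof -
  define C where "C = {c \<in> S. a < c \<and> c < b}"
  have eq: "{(x, y) \<in> ascending_pairs S. transpose a b y < transpose a b x}
      = insert (a, b) ({a} \<times> C \<union> C \<times> {b})"
    using ab by (auto simp: ascending_pairs_def C_def transpose_def split: if_splits)
  have fin: "finite C" using S by (simp add: C_def)
  have "card ({a} \<times> C \<union> C \<times> {b}) = card ({a} \<times> C) + card (C \<times> {b})"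
    using fin by (intro card_Un_disjoint) (auto simp: C_def)
  then have "card (insert (a, b) ({a} \<times> C \<union> C \<times> {b})) = Suc (2 * card C)"
    using fin by (subst card_insert_disjoint) (auto simp: C_def card_cartesian_product)
  then show ?thesis by (simp add: eq)
qed

text \<open>Moving both entries of an ascending pair and sorting them again permutes the ascending
  pairs. The sorting costs a factor \<open>- 1\<close> exactly at the inverted pairs, and their
  number is odd.\<close>

lemma prod_ascending_pairs_transpose:
  fixes F :: "'a::linorder \<Rightarrow> 'a \<Rightarrow> 'b::comm_ring_1"
  assumes S: "finite S" and ab: "a \<in> S" "b \<in> S" "a < b"
    and anti: "\<And>x y. F y x = - F x y"
  shows "(\<Prod>(x, y)\<in>ascending_pairs S. F (transpose a b x) (transpose a b y))
    = - (\<Prod>(x, y)\<in>ascending_pairs S. F x y)"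
proof -
  let ?t = "transpose a b" and ?P = "ascending_pairs S"
  \<comment> \<open>Transpose both entries, then restore ascending order; on ascending pairs this
    map is its own inverse.\<close>
  define h where "h = (\<lambda>(x, y). if ?t x < ?t y then (?t x, ?t y) else (?t y, ?t x))"
  have tS: "?t x \<in> S" if "x \<in> S" for x
    using that ab by (auto simp: transpose_def)
  have t_eq: "?t x = ?t y \<longleftrightarrow> x = y" for x y
    by (metis transpose_involutory)
  have hP: "h z \<in> ?P" if "z \<in> ?P" for z
    using that tS by (cases z) (auto simp: h_def ascending_pairs_def not_less_iff_gr_or_eq t_eq)
  have hh: "h (h z) = z" if "z \<in> ?P" for z
    using that by (cases z) (auto simp: h_def ascending_pairs_def)
  have "(\<Prod>(x, y)\<in>?P. F (?t x) (?t y))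
      = (\<Prod>z\<in>?P. (if ?t (snd z) < ?t (fst z) then - 1 else 1) * (case h z of (x, y) \<Rightarrow> F x y))"
  proof (intro prod.cong refl)
    fix z assume "z \<in> ?P"
    then show "(case z of (x, y) \<Rightarrow> F (?t x) (?t y))
        = (if ?t (snd z) < ?t (fst z) then - 1 else 1) * (case h z of (x, y) \<Rightarrow> F x y)"
      using anti[of "?t (fst z)" "?t (snd z)"]
      by (cases z) (auto simp: h_def ascending_pairs_def not_less_iff_gr_or_eq t_eq)
  qed
  also have "\<dots> = (\<Prod>z\<in>?P. if ?t (snd z) < ?t (fst z) then - 1 else 1)
      * (\<Prod>z\<in>?P. case h z of (x, y) \<Rightarrow> F x y)"
    by (rule prod.distrib)
  also have "(\<Prod>z\<in>?P. if ?t (snd z) < ?t (fst z) then - 1 else 1)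
      = (- 1 :: 'b) ^ card {z \<in> ?P. ?t (snd z) < ?t (fst z)}"
    using S by (simp add: prod.If_cases Int_def)
  also have "{z \<in> ?P. ?t (snd z) < ?t (fst z)} = {(x, y) \<in> ?P. ?t y < ?t x}"
    by auto
  also have "(\<Prod>z\<in>?P. case h z of (x, y) \<Rightarrow> F x y) = (\<Prod>(x, y)\<in>?P. F x y)"
    by (rule prod.reindex_bij_witness[of _ h h]) (use hP hh in auto)
  finally show ?thesis
    using odd_card_inversions_transpose[OF S ab] by simp
qed

lemma prod_ascending_pairs_permutes:
  fixes F :: "'a::linorder \<Rightarrow> 'a \<Rightarrow> 'b::comm_ring_1"
  assumes q: "q permutes S" and S: "finite S"
    and anti: "\<And>x y. F y x = - F x y"
  shows "(\<Prod>(x, y)\<in>ascending_pairs S. F (q x) (q y))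
    = of_int (sign q) * (\<Prod>(x, y)\<in>ascending_pairs S. F x y)"
  using q S anti
proof (induction q arbitrary: F rule: permutes_induct)
  case id
  show ?case by simp
next
  case (swap a b q)
  have perm: "permutation q" using swap.hyps S by (auto simp: permutation_permutes)
  \<comment> \<open>The outer transposition is absorbed into \<open>F\<close>, so that the induction
    hypothesis removes \<open>q\<close>; this is why \<open>F\<close> is kept arbitrary.\<close>
  have "(\<Prod>(x, y)\<in>ascending_pairs S. F ((transpose a b \<circ> q) x) ((transpose a b \<circ> q) y))
      = of_int (sign q) * (\<Prod>(x, y)\<in>ascending_pairs S. F (transpose a b x) (transpose a b y))"
    unfolding comp_apply
    by (rule swap.IH[where F = "\<lambda>x y. F (transpose a b x) (transpose a b y)"]) (rule swap.prems)+
  also have "(\<Prod>(x, y)\<in>ascending_pairs S. F (transpose a b x) (transpose a b y))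
      = - (\<Prod>(x, y)\<in>ascending_pairs S. F x y)"
  proof (cases "a < b")
    case True
    with S swap.hyps swap.prems show ?thesis by (intro prod_ascending_pairs_transpose)
  next
    case False
    \<comment> \<open>A transposition is symmetric in its two points, so they may be exchanged to
      have the smaller one first.\<close>
    then have "b < a" using swap.hyps by simp
    then show ?thesis
      unfolding transpose_commute[of a b] using S swap.hyps swap.prems
      by (intro prod_ascending_pairs_transpose)
  qed
  also have "of_int (sign q) * - (\<Prod>(x, y)\<in>ascending_pairs S. F x y)
      = of_int (sign (transpose a b \<circ> q)) * (\<Prod>(x, y)\<in>ascending_pairs S. F x y)"
    using swap.hyps by (simp only: sign_compose[OF permutation_swap_id perm] sign_swap_id) simp
  finally show ?case .
qed

text \<open>Since \<open>ys\<close> is strictly increasing, pairs of positions \<open>i < j\<close>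
  correspond to ascending pairs of values. The entries of \<open>xs\<close> are the images of those
  of \<open>ys\<close> under the inverse of \<open>r\<close>, which has the same sign as
  \<open>r\<close>.\<close>

lemma prod_list_pairs_sorted:
  fixes F :: "'a::linorder \<Rightarrow> 'a \<Rightarrow> 'b::comm_ring_1"
  assumes r: "r permutes set ys" "map r xs = ys" and ys: "sorted ys" "distinct ys"
    and anti: "\<And>x y. F y x = - F x y"
  shows "(\<Prod>(i, j)\<in>{(i, j). i < j \<and> j < length xs}. F (xs ! i) (xs ! j))
    = of_int (sign r) * (\<Prod>(x, y)\<in>ascending_pairs (set ys). F x y)"
proof -
  let ?q = "Hilbert_Choice.inv r"
  have len: "length xs = length ys" using r(2) by auto
  have nth: "xs ! i = ?q (ys ! i)" if "i < length ys" for i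
    using that r len by (metis nth_map permutes_inverses(2))
  have less: "ys ! i < ys ! j" if "i < j" "j < length ys" for i j
    using that ys by (simp add: sorted_wrt_nth_less strict_sorted_iff)
  have inj: "bij_betw (\<lambda>(i, j). (ys ! i, ys ! j)) {(i, j). i < j \<and> j < length ys}
      (ascending_pairs (set ys))"
  proof (rule bij_betwI')
    fix z z' assume "z \<in> {(i, j). i < j \<and> j < length ys}" "z' \<in> {(i, j). i < j \<and> j < length ys}"
    then show "((case z of (i, j) \<Rightarrow> (ys ! i, ys ! j)) = (case z' of (i, j) \<Rightarrow> (ys ! i, ys ! j)))
        = (z = z')"
      using ys(2) by (auto simp: nth_eq_iff_index_eq)
  next
    fix z assume "z \<in> {(i, j). i < j \<and> j < length ys}"
    then show "(case z of (i, j) \<Rightarrow> (ys ! i, ys ! j)) \<in> ascending_pairs (set ys)"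
      using less by (auto simp: ascending_pairs_def)
  next
    fix w assume "w \<in> ascending_pairs (set ys)"
    then obtain i j where w: "w = (ys ! i, ys ! j)" "i < length ys" "j < length ys" "ys ! i < ys ! j"
      by (auto simp: ascending_pairs_def in_set_conv_nth)
    then have "i < j" using less[of j i] by (metis linorder_neqE_nat order_less_asym order_less_irrefl)
    then show "\<exists>z\<in>{(i, j). i < j \<and> j < length ys}. w = (case z of (i, j) \<Rightarrow> (ys ! i, ys ! j))"
      using w by auto
  qed
  have "(\<Prod>(i, j)\<in>{(i, j). i < j \<and> j < length xs}. F (xs ! i) (xs ! j))
      = (\<Prod>(x, y)\<in>ascending_pairs (set ys). F (?q x) (?q y))"
    unfolding prod.reindex_bij_betw[OF inj, symmetric]
    by (intro prod.cong) (auto simp: len nth)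
  also have "\<dots> = of_int (sign ?q) * (\<Prod>(x, y)\<in>ascending_pairs (set ys). F x y)"
    by (rule prod_ascending_pairs_permutes[OF permutes_inv[OF r(1)] _ anti]) simp
  also have "sign ?q = sign r"
    using r(1) by (intro sign_inverse) (auto simp: permutation_permutes)
  finally show ?thesis .
qed

section \<open>Signs of the sine factors\<close>

lemma sgn_prod:
  fixes f :: "'a \<Rightarrow> 'b::linordered_idom"
  shows "sgn (prod f A) = (\<Prod>x\<in>A. sgn (f x))"
  by (induction A rule: infinite_finite_induct) (simp_all add: sgn_mult)

text \<open>Reduction modulo \<open>p\<close> shifts the angle by an integer multiple of
  \<open>2 * pi\<close>. This connects \<open>U p\<close>, built from unreduced squares, with the
  residues in \<open>square_seq p\<close>.\<close>

lemma sin_two_pi_mod: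
  assumes "p > 0"
  shows "sin (2 * pi * real_of_int (a - b) / real_of_int p)
    = sin (2 * pi * real_of_int (a mod p - b mod p) / real_of_int p)"
proof -
  have "a - b = (a mod p - b mod p) + p * (a div p - b div p)"
    by (simp add: algebra_simps)
  then have "real_of_int (a - b) = real_of_int (a mod p - b mod p) + real_of_int p * real_of_int (a div p - b div p)"
    by (metis of_int_add of_int_mult)
  then have "2 * pi * real_of_int (a - b) / real_of_int p
      = 2 * pi * real_of_int (a mod p - b mod p) / real_of_int p + 2 * pi * real_of_int (a div p - b div p)"
    using assms by (simp only: add_divide_distrib distrib_left) simp
  then show ?thesis by (simp only: sin_add sin_int_2pin cos_int_2pin mult_1_right mult_zero_right add_0_right)
qed

text \<open>The angle lies strictly between \<open>0\<close> and \<open>2 * pi\<close>, and it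
  exceeds \<open>pi\<close> exactly when \<open>2 * k > p\<close>; the third assumption excludes the
  zero at \<open>pi\<close>.\<close>

lemma sgn_sin_two_pi:
  fixes k p :: int
  assumes "0 < k" "k < p" "2 * k \<noteq> p"
  shows "sgn (sin (2 * pi * real_of_int k / real_of_int p)) = (if 2 * k > p then - 1 else 1)"
proof (cases "2 * k > p")
  case True
  have "pi < 2 * pi * real_of_int k / real_of_int p"
    using True assms by (simp add: pos_less_divide_eq mult.commute)
  moreover have "2 * pi * real_of_int k / real_of_int p < 2 * pi"
    using assms by (simp add: pos_divide_less_eq)
  ultimately show ?thesis using True sin_lt_zero by simp
next
  case False
  then have "2 * k < p" using assms by simp
  then have "2 * pi * real_of_int k / real_of_int p < pi"
    using assms by (simp add: pos_divide_less_eq mult.commute)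
  moreover have "0 < 2 * pi * real_of_int k / real_of_int p" using assms by simp
  ultimately show ?thesis using False sin_gt_zero by simp
qed

section \<open>Biquadratic residues under negation\<close>

lemma quartic_minus_one:
  fixes p :: int
  assumes "prime p" "[p = 1] (mod 8)"
  obtains z where "[z ^ 4 = - 1] (mod p)"
proof -
  define q where "q = nat p"
  have pq: "p = int q" using prime_gt_0_int[OF assms(1)] by (simp add: q_def)
  have q: "prime q" using assms(1) pq by simp
  obtain g where g: "residue_primroot q g" using prime_primitive_root_exists[OF prime_gt_1_nat[OF q] q] ..
  define m where "m = q div 8"
  have "int (q mod 8) = 1" using assms(2) by (simp add: cong_def pq zmod_int)
  then have "q mod 8 = 1" by simp
  then have "q = 8 * m + 1" using div_mult_mod_eq[of q 8] by (simp add: m_def)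
  then have m: "q - 1 = 8 * m" "m > 0" using prime_gt_1_nat[OF q] by auto
  have ord: "ord q g = 8 * m" using g q m(1) by (simp add: residue_primroot_def totient_prime)
  \<comment> \<open>As \<open>m = (p - 1) / 8\<close> and \<open>g\<close> is a primitive root,
    \<open>x\<close> has order 8. Hence \<open>x ^ 4\<close> is a square root of 1 different from 1,
    which can only be \<open>- 1\<close> modulo a prime.\<close>
  define x where "x = int g ^ m"
  have pow_eq_1: "p dvd x ^ k - 1 \<longleftrightarrow> 8 * m dvd k * m" for k
  proof -
    have "p dvd x ^ k - 1 \<longleftrightarrow> [int (g ^ (k * m)) = int 1] (mod int q)"
      by (simp add: x_def pq cong_iff_dvd_diff mult.commute flip: power_mult)
    also have "\<dots> \<longleftrightarrow> [g ^ (k * m) = 1] (mod q)" by (rule cong_int_iff)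
    finally show ?thesis by (simp only: ord_divides ord)
  qed
  have "p dvd (x ^ 4 - 1) * (x ^ 4 + 1)"
    using pow_eq_1[of 8] by (simp add: algebra_simps flip: power_add)
  moreover have "\<not> p dvd x ^ 4 - 1"
    using pow_eq_1[of 4] m(2) by (auto dest: dvd_imp_le)
  ultimately have "p dvd x ^ 4 + 1"
    using assms(1) by (simp add: prime_dvd_mult_iff)
  then show thesis using that[of x] by (simp add: cong_iff_dvd_diff)
qed

lemma quartic_symbol_eq_1_iff:
  "quartic_symbol x p = 1 \<longleftrightarrow> \<not> p dvd x \<and> (\<exists>y. [y ^ 4 = x] (mod p))"
  by (auto simp: quartic_symbol_def)

lemma epsilon_eq_card_pairs:
  assumes "prime p" "[p = 1] (mod 8)"
  shows "epsilon p = card {(x, y) \<in> ascending_pairs (set (biquad_residues p)). 2 * (y - x) > p}"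
proof -
  obtain z where z: "[z ^ 4 = - 1] (mod p)" using quartic_minus_one[OF assms] .
  \<comment> \<open>Multiplying a fourth root of \<open>x\<close> by \<open>z\<close> gives a fourth
    root of \<open>- x\<close>.\<close>
  have neg: "\<exists>w. [w ^ 4 = p - x] (mod p)" if "\<exists>y. [y ^ 4 = x] (mod p)" for x
  proof -
    from that obtain y where "[y ^ 4 = x] (mod p)" ..
    with z have "[(z * y) ^ 4 = (- 1) * x] (mod p)"
      unfolding power_mult_distrib by (rule cong_mult)
    then have "[(z * y) ^ 4 = p - x] (mod p)" by (simp add: cong_def)
    then show ?thesis ..
  qed
  have nd: "\<not> p dvd x" if "0 < x" "x < p" for x using that by (simp add: zdvd_not_zless)
  let ?E = "{(x, y). 0 < x \<and> 0 < y \<and> 2 * (x + y) < p \<and> quartic_symbol x p = 1 \<and> quartic_symbol y p = 1}"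
  let ?D = "{(x, y) \<in> ascending_pairs (set (biquad_residues p)). 2 * (y - x) > p}"
  \<comment> \<open>The reflection is its own inverse. It turns \<open>2 * (x + y) < p\<close> into
    \<open>2 * ((p - y) - x) > p\<close>, which already forces \<open>x < p - y\<close>.\<close>
  have "bij_betw (\<lambda>(x, y). (x, p - y)) ?E ?D"
    by (rule bij_betw_byWitness[of _ "\<lambda>(x, y). (x, p - y)"])
       (auto simp: ascending_pairs_def quartic_symbol_eq_1_iff nd intro!: neg)
  then show ?thesis unfolding epsilon_def by (rule bij_betw_same_card)
qed

section \<open>Comparison of the sign of \<open>U p\<close> with that of the sorted product\<close>

theorem theorem2:
  fixes p :: int
  assumes "prime p" and "[p = 1] (mod 8)"
  shows "sign (rho p) = (-1) ^ (lambda p + epsilon p)"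
proof -
  let ?a = "half_quad_residues p" and ?B = "set (biquad_residues p)"
  define F where "F x y = sin (2 * pi * real_of_int (y - x) / real_of_int p)" for x y
  \<comment> \<open>The same product taken over the biquadratic residues in ascending order, where
    the sign of each factor can be read off.\<close>
  define V where "V = (\<Prod>(x, y)\<in>ascending_pairs ?B. F x y)"
  have p: "p > 0" using assms(1) by (rule prime_gt_0_int)
  have p4: "[p = 1] (mod 4)" using cong_dvd_modulus[OF assms(2), of 4] by simp
  have "odd p" using assms(2) by (auto simp: cong_def) presburger
  have r: "rho p permutes ?B" "map (rho p) (square_seq p) = biquad_residues p"
    using theI'[OF rho_unique[OF assms(1) p4]] by (simp_all add: rho_def)
  have anti: "F y x = - F x y" for x y
  proof -
    have "real_of_int (x - y) = - real_of_int (y - x)" by simp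
    then show ?thesis
      by (simp only: F_def mult_minus_right minus_divide_left[symmetric] sin_minus)
  qed
  have "U p = (\<Prod>(i, j)\<in>{(i, j). i < j \<and> j < length (square_seq p)}. F (square_seq p ! i) (square_seq p ! j))"
    unfolding U_def Let_def
  proof (rule prod.cong)
    fix z assume "z \<in> {(i, j). i < j \<and> j < length (square_seq p)}"
    then show "(case z of (i, j) \<Rightarrow> sin (2 * pi * real_of_int ((?a ! j)\<^sup>2 - (?a ! i)\<^sup>2) / real_of_int p))
        = (case z of (i, j) \<Rightarrow> F (square_seq p ! i) (square_seq p ! j))"
      using sin_two_pi_mod[OF p] by (auto simp: F_def square_seq_def)
  qed (simp add: square_seq_def)
  also have "\<dots> = of_int (sign (rho p)) * V"
    unfolding V_def by (rule prod_list_pairs_sorted[OF r _ _ anti]) (simp_all add: biquad_residues_def)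
  finally have UV: "U p = of_int (sign (rho p)) * V" .
  have "sgn V = (\<Prod>(x, y)\<in>ascending_pairs ?B. sgn (F x y))"
    by (simp add: V_def sgn_prod case_prod_unfold)
  also have "\<dots> = (\<Prod>z\<in>ascending_pairs ?B. if 2 * (snd z - fst z) > p then - 1 else 1)"
  proof (intro prod.cong refl)
    fix z assume "z \<in> ascending_pairs ?B"
    \<comment> \<open>Parity keeps the angle away from \<open>pi\<close>, so no factor
      vanishes.\<close>
    moreover have "2 * (snd z - fst z) \<noteq> p" using \<open>odd p\<close> by auto
    ultimately show "(case z of (x, y) \<Rightarrow> sgn (F x y)) = (if 2 * (snd z - fst z) > p then - 1 else 1)"
      unfolding F_def by (cases z, simp only: split fst_conv snd_conv, intro sgn_sin_two_pi)
        (auto simp: ascending_pairs_def)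
  qed
  also have "\<dots> = (- 1) ^ card {z \<in> ascending_pairs ?B. 2 * (snd z - fst z) > p}"
    by (simp add: prod.If_cases Int_def del: set_biquad_residues)
  also have "{z \<in> ascending_pairs ?B. 2 * (snd z - fst z) > p}
      = {(x, y) \<in> ascending_pairs ?B. 2 * (y - x) > p}"
    by auto
  finally have "sgn V = (- 1) ^ epsilon p"
    using epsilon_eq_card_pairs[OF assms] by simp
  then have "sgn (U p) = of_int (sign (rho p)) * (- 1) ^ epsilon p"
    by (simp add: UV sgn_mult sign_def)
  \<comment> \<open>\<open>lambda p\<close> would also be 1 if \<open>U p\<close> were 0, so
    nonvanishing is needed to conclude that the sign is then \<open>- 1\<close>.\<close>
  moreover have "sgn (U p) = (- 1) ^ lambda p"
    using U_nonzero[OF assms(1) p4] by (auto simp: lambda_def)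
  \<comment> \<open>Both expressions for \<open>sgn (U p)\<close> are equated. As
    \<open>(- 1) ^ epsilon p\<close> is its own inverse, it moves to the other side; the parity
    cases carry this out.\<close>
  ultimately have "real_of_int (sign (rho p)) = real_of_int ((- 1) ^ (lambda p + epsilon p))"
    by (cases "even (epsilon p)"; cases "even (lambda p)") (auto simp: power_add)
  then show ?thesis by (simp only: of_int_eq_iff)
qed

end
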